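(* Each component of a weighted Hankel graph is isomorphic to a weighted Hankel graph under the normalized labeling of its vertex set.
   Context: For real numbers $a_0,\ldots,a_{2n-2}$, $H[a_0,\ldots,a_{2n-2}]$ denotes the $n\times n$ Hankel matrix whose entry in row $i$, column $j$ (indexed $0,\ldots,n-1$) is $a_{i+j}$. For such $A$, $T_A=\{i\colon\, a_i\neq 0\}$ and $w_A(t)=a_t$. The weighted Hankel graph $G(A)$ of a Hankel matrix $A$ is the edge-weighted graph (loops allowed) with vertex set $\{0,1,\ldots,n-1\}$, where $i$ and $j$ are adjacent iff $i+j\in T_A$, with edge $ij$ of weight $w_A(i+j)$. A component is a maximal connected subgraph. If the vertex set of a component is $n_0<n_1<\cdots<n_{k-1}$, its normalized labeling is the relabeling $n_i\mapsto i$ (labels $0,\ldots,k-1$). Isomorphism is of edge-weighted graphs (preserving adjacency and weights). *)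

theory Defs
  imports "Jordan_Normal_Form.Matrix"
begin

text \<open>
  Undirected edge-weighted graphs, loops allowed. An edge $uv$ is encoded by the symmetric
  relation \<open>adj\<close>; the values of \<open>weight\<close> are meaningful on adjacent pairs only, and
  no definition below looks at them elsewhere.
\<close>

record 'a wgraph =
  verts :: "'a set"
  adj :: "'a \<Rightarrow> 'a \<Rightarrow> bool"
  weight :: "'a \<Rightarrow> 'a \<Rightarrow> real"

definition wf_wgraph :: "'a wgraph \<Rightarrow> bool" where
  "wf_wgraph G \<longleftrightarrow>
     (\<forall>u v. adj G u v \<longrightarrow> u \<in> verts G \<and> v \<in> verts G \<and> adj G v u \<and> weight G v u = weight G u v)"

definition subgraph :: "'a wgraph \<Rightarrow> 'a wgraph \<Rightarrow> bool" where
  "subgraph H G \<longleftrightarrow> wf_wgraph H \<and> verts H \<subseteq> verts G \<and>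
     (\<forall>u v. adj H u v \<longrightarrow> adj G u v \<and> weight H u v = weight G u v)"

definition connected_wgraph :: "'a wgraph \<Rightarrow> bool" where
  "connected_wgraph G \<longleftrightarrow> verts G \<noteq> {} \<and> (\<forall>u\<in>verts G. \<forall>v\<in>verts G. (adj G)\<^sup>*\<^sup>* u v)"

text \<open>
  Maximality is with respect to the preorder \<open>subgraph\<close>: two records that are subgraphs of each
  other differ only in the irrelevant weights of non-adjacent pairs.
\<close>

definition component :: "'a wgraph \<Rightarrow> 'a wgraph \<Rightarrow> bool" where
  "component C G \<longleftrightarrow> subgraph C G \<and> connected_wgraph C \<and>
     (\<forall>H. subgraph H G \<and> connected_wgraph H \<and> subgraph C H \<longrightarrow> subgraph H C)"

definition wgraph_iso :: "('a \<Rightarrow> 'b) \<Rightarrow> 'a wgraph \<Rightarrow> 'b wgraph \<Rightarrow> bool" where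
  "wgraph_iso f G H \<longleftrightarrow> bij_betw f (verts G) (verts H) \<and>
     (\<forall>u\<in>verts G. \<forall>v\<in>verts G.
        (adj G u v \<longleftrightarrow> adj H (f u) (f v)) \<and>
        (adj G u v \<longrightarrow> weight G u v = weight H (f u) (f v)))"

text \<open>
  \<open>hankel_mat n a\<close> is $H[a_0,\ldots,a_{2n-2}]$; the values of \<open>a\<close> beyond $2n-2$ are not used.
\<close>

definition hankel_mat :: "nat \<Rightarrow> (nat \<Rightarrow> real) \<Rightarrow> real mat" where
  "hankel_mat n a = mat n n (\<lambda>(i, j). a (i + j))"

definition is_hankel :: "real mat \<Rightarrow> bool" where
  "is_hankel A \<longleftrightarrow> (\<exists>n a. n \<ge> 1 \<and> A = hankel_mat n a)"

text \<open>
  $w_A(t) = a_t$ for $t \le 2n-2$, read off at the position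
  $(\min(t, n-1),\, \max(t-(n-1), 0))$ of the $t$-th antidiagonal (the subtraction is truncated).
\<close>

definition hankel_weight :: "real mat \<Rightarrow> nat \<Rightarrow> real" where
  "hankel_weight A t = A $$ (min t (dim_row A - 1), t - (dim_row A - 1))"

lemma hankel_weight_hankel_mat:
  assumes "n \<ge> 1" "t \<le> 2 * n - 2"
  shows "hankel_weight (hankel_mat n a) t = a t"
proof -
  have "min t (n - 1) < n" "t - (n - 1) < n" "min t (n - 1) + (t - (n - 1)) = t"
    using assms by auto
  then show ?thesis
    by (simp add: hankel_weight_def hankel_mat_def)
qed

definition hankel_support :: "real mat \<Rightarrow> nat set" where
  "hankel_support A = {t. t \<le> 2 * dim_row A - 2 \<and> hankel_weight A t \<noteq> 0}"

definition hankel_graph :: "real mat \<Rightarrow> nat wgraph" where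
  "hankel_graph A =
     \<lparr> verts = {..<dim_row A},
       adj = (\<lambda>i j. i < dim_row A \<and> j < dim_row A \<and> i + j \<in> hankel_support A),
       weight = (\<lambda>i j. hankel_weight A (i + j)) \<rparr>"

lemma wf_hankel_graph: "wf_wgraph (hankel_graph A)"
  by (simp add: wf_wgraph_def hankel_graph_def add.commute)

text \<open>
  The inverse of $i \mapsto n_i$, where $n_0 < \cdots < n_{k-1}$ lists the finite set \<open>V\<close>.
\<close>

definition normalized_labeling :: "nat set \<Rightarrow> nat \<Rightarrow> nat" where
  "normalized_labeling V = the_inv_into {..<card V} (\<lambda>i. sorted_list_of_set V ! i)"

lemma normalized_labeling_nth:
  assumes "finite V" "i < card V"
  shows "normalized_labeling V (sorted_list_of_set V ! i) = i"
proof -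
  have "inj_on (\<lambda>i. sorted_list_of_set V ! i) {..<card V}"
    using assms by (auto simp: inj_on_def nth_eq_iff_index_eq)
  then show ?thesis
    unfolding normalized_labeling_def using assms by (simp add: the_inv_into_f_f)
qed

end

theory Submission
  imports Defs
begin

text \<open>
  For each \<open>t\<close> in the support, the reflection \<open>x \<mapsto> t - x\<close> preserves the part of the component
  \<open>V\<close> lying in the interval of those \<open>x\<close> for which both \<open>x\<close> and \<open>t - x\<close> are vertices. This
  interval is an initial or a final segment of the vertex set, so it consists of consecutive
  members of \<open>V\<close>, and reversing it shows that the positions of \<open>x\<close> and \<open>t - x\<close> in \<open>V\<close> have a sum
  depending on \<open>t\<close> only. Conversely, because the segment is initial or final, any two members of
  \<open>V\<close> whose positions have this sum lie in it, hence add up to \<open>t\<close>. So along each antidiagonal of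
  the relabelled component the weight is constant.
\<close>

text \<open>The subgraph \<open>H\<close> of \<open>G\<close> induced on all vertices reachable from
  \<open>u\<close> is connected and contains \<open>C\<close>, so maximality puts every edge of
  \<open>H\<close> at \<open>u\<close> into \<open>C\<close>.\<close>

lemma component_neighbour:
  assumes G: "wf_wgraph G" and C: "component C G"
    and u: "u \<in> verts C" and uv: "adj G u v"
  shows "v \<in> verts C" and "adj C u v"
proof -
  have sub: "subgraph C G" and con: "connected_wgraph C"
    using C by (auto simp: component_def)
  define S where "S = {v. (adj G)\<^sup>*\<^sup>* u v}"
  define H where "H = \<lparr>verts = S, adj = (\<lambda>x y. x \<in> S \<and> y \<in> S \<and> adj G x y), weight = weight G\<rparr>"
  have step: "y \<in> S" if "x \<in> S" "adj G x y" for x y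
    using that by (auto simp: S_def)
  have uS: "u \<in> S" by (simp add: S_def)
  have sym: "symp (adj H)"
    using G by (auto simp: symp_def H_def wf_wgraph_def)
  have uG: "u \<in> verts G" using sub u by (auto simp: subgraph_def)
  have SG: "S \<subseteq> verts G"
  proof
    fix x assume "x \<in> S"
    then have "(adj G)\<^sup>*\<^sup>* u x" by (simp add: S_def)
    then show "x \<in> verts G"
      by induction (use uG G in \<open>auto simp: wf_wgraph_def\<close>)
  qed
  have HG: "subgraph H G"
    using G SG by (auto simp: subgraph_def H_def wf_wgraph_def)
  have path: "(adj H)\<^sup>*\<^sup>* u x" if "x \<in> S" for x
  proof -
    have "(adj G)\<^sup>*\<^sup>* u x" using that by (simp add: S_def)
    then show ?thesis
    proof induction
      case (step y z)
      then have "adj H y z" by (auto simp: H_def S_def)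
      with step.IH show ?case by simp
    qed simp
  qed
  have H: "connected_wgraph H"
    unfolding connected_wgraph_def
  proof (intro conjI ballI)
    show "verts H \<noteq> {}" using uS by (auto simp: H_def)
    fix x y assume "x \<in> verts H" "y \<in> verts H"
    then have "(adj H)\<^sup>*\<^sup>* u x" "(adj H)\<^sup>*\<^sup>* u y"
      by (intro path; simp add: H_def)+
    then show "(adj H)\<^sup>*\<^sup>* x y"
      using symp_rtranclp[OF sym] by (meson rtranclp_trans sympD)
  qed
  have CS: "verts C \<subseteq> S"
  proof
    fix x assume "x \<in> verts C"
    then have "(adj C)\<^sup>*\<^sup>* u x" using con u by (auto simp: connected_wgraph_def)
    then have "(adj G)\<^sup>*\<^sup>* u x"
      by (rule rtranclp_mono[THEN predicate2D, rotated]) (use sub in \<open>auto simp: subgraph_def\<close>)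
    then show "x \<in> S" by (simp add: S_def)
  qed
  have "subgraph C H"
    using sub CS by (fastforce simp: subgraph_def H_def wf_wgraph_def)
  with C HG H have "subgraph H C" by (auto simp: component_def)
  moreover have "adj H u v" using step[OF uS uv] uS uv by (simp add: H_def)
  ultimately show "adj C u v" by (auto simp: subgraph_def)
  then show "v \<in> verts C" using sub by (auto simp: subgraph_def wf_wgraph_def)
qed

lemma bij_betw_nth_sorted_list_of_set:
  assumes "finite V"
  shows "bij_betw ((!) (sorted_list_of_set V)) {..<card V} V"
  using assms by (intro bij_betw_nth) simp_all

lemma bij_betw_normalized_labeling:
  assumes "finite V"
  shows "bij_betw (normalized_labeling V) V {..<card V}"
  unfolding normalized_labeling_def
  by (rule bij_betw_the_inv_into[OF bij_betw_nth_sorted_list_of_set[OF assms]])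

text \<open>A label is a rank: the smaller elements of \<open>V\<close> are those listed at earlier
  positions. This turns sums of labels into counting.\<close>

lemma normalized_labeling_eq_card:
  assumes V: "finite V" and x: "x \<in> V"
  shows "normalized_labeling V x = card {v \<in> V. v < x}"
proof -
  let ?xs = "sorted_list_of_set V"
  have img: "(!) ?xs ` {..<card V} = V" and inj: "inj_on ((!) ?xs) {..<card V}"
    using bij_betw_nth_sorted_list_of_set[OF V] by (simp_all add: bij_betw_def)
  obtain i where i: "i < card V" "x = ?xs ! i"
    using x img by blast
  have less: "?xs ! a < ?xs ! b" if "a < b" "b < card V" for a b
    using sorted_wrt_nth_less[OF strict_sorted_list_of_set that(1)] that(2) by simp
  have "{v \<in> V. v < x} = (!) ?xs ` {..<i}"
  proof (intro equalityI subsetI)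
    fix v assume v: "v \<in> {v \<in> V. v < x}"
    then obtain a where a: "a < card V" "v = ?xs ! a" using img by blast
    have "a < i"
      using v less[of i a] i a by (cases a i rule: linorder_cases) simp_all
    then show "v \<in> (!) ?xs ` {..<i}" using a by blast
  next
    fix v assume "v \<in> (!) ?xs ` {..<i}"
    then obtain a where a: "a < i" "v = ?xs ! a" by blast
    moreover have "?xs ! a \<in> V" using a i img by fastforce
    ultimately show "v \<in> {v \<in> V. v < x}" using less[of a i] i by simp
  qed
  moreover have "inj_on ((!) ?xs) {..<i}"
    using inj i by (auto intro: inj_on_subset)
  ultimately have "card {v \<in> V. v < x} = i"
    by (simp add: card_image)
  then show ?thesis
    using normalized_labeling_nth[OF V i(1)] i(2) by simp
qed

text \<open>Reflection in \<open>t\<close> exchanges the members of \<open>V\<close> in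
  [a, x) with those in (t - x, b]. Hence whatever the rank of \<open>x\<close> gains over that of
  \<open>a\<close>, the rank of \<open>t - x\<close> loses at the upper end.\<close>

lemma card_less_reflected:
  fixes V :: "nat set"
  assumes V: "finite V" and ab: "a + b = t"
    and refl: "\<And>x. x \<in> V \<Longrightarrow> a \<le> x \<Longrightarrow> x \<le> b \<Longrightarrow> t - x \<in> V"
    and x: "x \<in> V" "a \<le> x" "x \<le> b"
  shows "card {v \<in> V. v < x} + card {v \<in> V. v < t - x} + 1
         = card {v \<in> V. v < a} + card {v \<in> V. v \<le> b}"
proof -
  have tx: "t - x \<in> V" using refl x by blast
  have "bij_betw (\<lambda>v. t - v) {v \<in> V. a \<le> v \<and> v < x} {v \<in> V. t - x < v \<and> v \<le> b}"
    by (rule bij_betw_byWitness[where f' = "\<lambda>v. t - v"]) (use x ab refl in auto)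
  then have eq: "card {v \<in> V. a \<le> v \<and> v < x} = card {v \<in> V. t - x < v \<and> v \<le> b}"
    by (rule bij_betw_same_card)
  have "{v \<in> V. v < x} = {v \<in> V. v < a} \<union> {v \<in> V. a \<le> v \<and> v < x}"
    using x by auto
  also have "card \<dots> = card {v \<in> V. v < a} + card {v \<in> V. a \<le> v \<and> v < x}"
    using V by (intro card_Un_disjoint) auto
  finally have 1: "card {v \<in> V. v < x} = card {v \<in> V. v < a} + card {v \<in> V. a \<le> v \<and> v < x}" .
  \<comment> \<open>The point \<open>t - x\<close> itself belongs to neither of the two counted
    parts; it is the source of the summand 1.\<close>
  have "{v \<in> V. v \<le> b} = insert (t - x) ({v \<in> V. v < t - x} \<union> {v \<in> V. t - x < v \<and> v \<le> b})"
    using x ab tx by auto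
  then have "card {v \<in> V. v \<le> b}
      = Suc (card ({v \<in> V. v < t - x} \<union> {v \<in> V. t - x < v \<and> v \<le> b}))"
    using V by simp
  also have "card ({v \<in> V. v < t - x} \<union> {v \<in> V. t - x < v \<and> v \<le> b})
      = card {v \<in> V. v < t - x} + card {v \<in> V. t - x < v \<and> v \<le> b}"
    using V by (intro card_Un_disjoint) auto
  finally show ?thesis using 1 eq by simp
qed

lemma sum_eq_if_labeling_sum_eq:
  assumes V: "V \<subseteq> {..<n}"
    and refl: "\<And>x. x \<in> V \<Longrightarrow> x \<le> t \<Longrightarrow> t - x < n \<Longrightarrow> t - x \<in> V"
    and xy: "x \<in> V" "y \<in> V" "x + y = t"
    and uv: "u \<in> V" "v \<in> V"
    and eq: "normalized_labeling V u + normalized_labeling V v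
             = normalized_labeling V x + normalized_labeling V y"
  shows "u + v = t"
proof -
  have fin: "finite V" using V finite_subset by blast
  \<comment> \<open>[a, b] holds exactly the vertices whose reflection in \<open>t\<close> is again
    a vertex. Truncation gives \<open>a = 0\<close> for \<open>t \<le> n - 1\<close>; otherwise
    \<open>b = n - 1\<close>.\<close>
  define a where "a = t - (n - 1)"
  define b where "b = min t (n - 1)"
  have lt: "x < n" "y < n" "u < n" "v < n" using V xy uv by auto
  have ab: "a + b = t" by (auto simp: a_def b_def)
  have refl': "t - z \<in> V" if "z \<in> V" "a \<le> z" "z \<le> b" for z
    using that lt by (intro refl) (auto simp: a_def b_def)
  note card_eq = card_less_reflected[OF fin ab refl']
  let ?r = "\<lambda>z. card {v \<in> V. v < z}"
  have "t - x = y" using xy by simp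
  then have "?r x + ?r y + 1 = ?r a + card {v \<in> V. v \<le> b}"
    using card_eq[OF _ _ _ xy(1)] xy lt by (auto simp: a_def b_def)
  then have sum: "?r u + ?r v + 1 = ?r a + card {v \<in> V. v \<le> b}"
    using eq fin xy uv by (simp add: normalized_labeling_eq_card)
  have card_less: "card X < card Y" if "finite Y" "X \<subseteq> Y" "z \<in> Y" "z \<notin> X" for X Y and z :: nat
    by (rule psubset_card_mono) (use that in blast)+
  \<comment> \<open>Below \<open>a\<close>, the segment is final, so both ranks stay under their
    bounds and the sum is too small.\<close>
  have "a \<le> u"
  proof (rule ccontr)
    assume "\<not> a \<le> u"
    then have "u < a" by simp
    then have b: "b = n - 1" by (auto simp: a_def b_def)
    have "?r u < ?r a"
      by (rule card_less[where z = u]) (use fin uv \<open>u < a\<close> in auto)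
    moreover have "?r v < card {v \<in> V. v \<le> b}"
      by (rule card_less[where z = v]) (use fin uv lt b in auto)
    ultimately show False using sum by simp
  qed
  \<comment> \<open>Above \<open>b\<close>, the segment is initial, and the rank of \<open>u\<close>
    alone already makes the sum too large.\<close>
  moreover have "u \<le> b"
  proof (rule ccontr)
    assume "\<not> u \<le> b"
    then have "u > b" by simp
    then have a: "a = 0" using lt by (auto simp: a_def b_def)
    have "card {v \<in> V. v \<le> b} \<le> ?r u"
      by (rule card_mono) (use fin \<open>u > b\<close> in auto)
    then show False using sum a by simp
  qed
  ultimately have "?r u + ?r (t - u) = ?r u + ?r v" and tu: "t - u \<in> V"
    using card_eq[OF _ _ _ uv(1)] refl' uv sum by auto
  then have "normalized_labeling V (t - u) = normalized_labeling V v"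
    using fin uv by (simp add: normalized_labeling_eq_card)
  then have "t - u = v"
    using bij_betw_normalized_labeling[OF fin] tu uv by (auto simp: bij_betw_def inj_on_def)
  then show ?thesis using \<open>u \<le> b\<close> by (auto simp: b_def)
qed

theorem theorem4p2:
  fixes A :: "real mat" and C :: "nat wgraph"
  assumes "is_hankel A"
    and "component C (hankel_graph A)"
  shows "\<exists>B. is_hankel B \<and>
           wgraph_iso (normalized_labeling (verts C)) C (hankel_graph B)"
proof -
  let ?G = "hankel_graph A"
  let ?n = "dim_row A"
  let ?T = "hankel_support A"
  let ?w = "hankel_weight A"
  define V where "V = verts C"
  define f where "f = normalized_labeling V"
  define k where "k = card V"
  have sub: "subgraph C ?G" and ne: "V \<noteq> {}"
    using assms(2) by (auto simp: component_def connected_wgraph_def V_def)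
  have Vn: "V \<subseteq> {..<?n}" using sub by (simp add: subgraph_def hankel_graph_def V_def)
  then have fin: "finite V" using finite_subset by blast
  have k: "k \<ge> 1" using fin ne by (simp add: k_def Suc_le_eq card_gt_0_iff)
  note neighbour = component_neighbour[OF wf_hankel_graph assms(2), folded V_def]
  have bij: "bij_betw f V {..<k}"
    unfolding f_def k_def by (rule bij_betw_normalized_labeling[OF fin])
  have adjC: "adj C x y \<longleftrightarrow> x + y \<in> ?T" if "x \<in> V" "y \<in> V" for x y
    using that Vn sub neighbour(2)[of x y] by (auto simp: subgraph_def hankel_graph_def)
  have refl: "t - x \<in> V" if "t \<in> ?T" "x \<in> V" "x \<le> t" "t - x < ?n" for t x
    using that Vn neighbour(1)[of x "t - x"] by (auto simp: hankel_graph_def)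
  have key: "u + v = x + y"
    if "x + y \<in> ?T" "x \<in> V" "y \<in> V" "u \<in> V" "v \<in> V" "f u + f v = f x + f y" for x y u v
    using sum_eq_if_labeling_sum_eq[OF Vn refl[OF that(1)] that(2,3) _ that(4,5)] that(6)
    by (simp add: f_def)
  \<comment> \<open>\<open>P s t\<close> says that some edge with label sum \<open>s\<close> has
    vertex sum \<open>t\<close>. Antidiagonals without an edge get the entry 0 in \<open>b\<close>,
    which keeps them out of the support.\<close>
  define P where "P s t \<longleftrightarrow> t \<in> ?T \<and> (\<exists>x\<in>V. \<exists>y\<in>V. x + y = t \<and> f x + f y = s)" for s t
  define b where "b s = (if \<exists>t. P s t then ?w (THE t. P s t) else 0)" for s
  have b_eq: "b (f x + f y) = (if x + y \<in> ?T then ?w (x + y) else 0)"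
    if "x \<in> V" "y \<in> V" for x y
  proof -
    \<comment> \<open>By \<open>key\<close>, any edge with the label sum of \<open>x\<close> and
      \<open>y\<close> has vertex sum \<open>x + y\<close>. So \<open>t\<close> is unique, and a
      non-adjacent pair never shares its antidiagonal with an edge.\<close>
    have P: "P (f x + f y) t \<longleftrightarrow> x + y \<in> ?T \<and> t = x + y" for t
      unfolding P_def using that key by metis
    show ?thesis unfolding b_def P by simp
  qed
  define B where "B = hankel_mat k b"
  have dim: "dim_row B = k" by (simp add: B_def hankel_mat_def)
  have iso: "(adj C x y \<longleftrightarrow> adj (hankel_graph B) (f x) (f y)) \<and>
      (adj C x y \<longrightarrow> weight C x y = weight (hankel_graph B) (f x) (f y))"
    if xy: "x \<in> V" "y \<in> V" for x y
  proof -
    have lt: "f x < k" "f y < k" using bij xy by (auto simp: bij_betw_def)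
    then have "f x + f y \<le> 2 * k - 2" by simp
    moreover from this have "hankel_weight B (f x + f y) = b (f x + f y)"
      unfolding B_def by (rule hankel_weight_hankel_mat[OF k])
    \<comment> \<open>Weights on the support are nonzero, so no edge is lost when adjacency is read
      off from the entries of \<open>B\<close>.\<close>
    moreover have "?w (x + y) \<noteq> 0" if "x + y \<in> ?T"
      using that by (simp add: hankel_support_def)
    ultimately have "adj (hankel_graph B) (f x) (f y) \<longleftrightarrow> x + y \<in> ?T"
      and "weight (hankel_graph B) (f x) (f y) = b (f x + f y)"
      using lt by (auto simp: hankel_graph_def dim hankel_support_def[of B] b_eq[OF xy])
    moreover have "weight C x y = ?w (x + y)" if "adj C x y"
      using sub that by (auto simp: subgraph_def hankel_graph_def)
    ultimately show ?thesis using adjC[OF xy] b_eq[OF xy] by simp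
  qed
  have "wgraph_iso f C (hankel_graph B)"
    unfolding wgraph_iso_def using bij iso by (simp add: V_def hankel_graph_def dim)
  moreover have "is_hankel B"
    using k by (auto simp: is_hankel_def B_def)
  ultimately show ?thesis unfolding f_def V_def by blast
qed

end
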